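(* Let $p\ge 2$, let $\tau>0$, and let $\kappa>0$ satisfy $A_p(\kappa)\,\kappa = 1/\tau$, where $A_p(\kappa)=I_{p/2}(\kappa)/I_{p/2-1}(\kappa)$. For a unit vector $z\in\mathbb{S}^{p-1}$ let $\mathcal{D}(z)$ denote the von Mises–Fisher distribution on $\mathbb{S}^{p-1}$ with mean direction $z$ and concentration $\kappa$ (this is the case $m=1$ of a single view per distribution, with both distributions having the same concentration $\kappa_1=\kappa_2=\kappa$). Define $\mathrm{sim}_{\mathrm{cos}}(x,y)=x^{T}y$ and $\mathrm{sim}_{\mathrm{div}}(\mathcal{D}_1,\mathcal{D}_2)=-D_{\mathrm{KL}}(\mathcal{D}_1\,\|\,\mathcal{D}_2)$. Then there is a constant $C$ (not depending on $z_i,z_j$) such that for all $z_i,z_j\in\mathbb{S}^{p-1}$, $$\mathrm{sim}_{\mathrm{div}}(\mathcal{D}(z_i),\mathcal{D}(z_j)) = \frac{\mathrm{sim}_{\mathrm{cos}}(z_i,z_j)}{\tau} + C.$$ Furthermore, for any anchor $z_i$, positive $z_i^{+}$ and negatives $z_j$ ($j\neq i$, $K$ of them) in $\mathbb{S}^{p-1}$, the InfoNCE loss computed with $\mathrm{sim}_{\mathrm{div}}$ on the distributions $\mathcal{D}(z_i),\mathcal{D}(z_i^+),\mathcal{D}(z_j)$ equals the InfoNCE loss computed with $\mathrm{sim}_{\mathrm{cos}}$ and temperature $\tau$ on $z_i,z_i^+,z_j$: $$L^{\mathrm{div}}_{i,\mathrm{InfoNCE}} = L^{\mathrm{cos}}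_{i,\mathrm{InfoNCE}}.$$
   Context: $I_\nu$ denotes the modified Bessel function of the first kind of order $\nu$. The von Mises–Fisher (vMF) distribution $\mathcal{D}(\mu,\kappa)$ on the unit sphere $\mathbb{S}^{p-1}\subset\mathbb{R}^p$ with mean direction $\mu\in\mathbb{S}^{p-1}$ and concentration $\kappa>0$ has density $f_p(x;\mu,\kappa)=c_p(\kappa)\exp(\kappa\,\mu^{T}x)$ with respect to surface measure, where $c_p(\kappa)=\kappa^{p/2-1}/\big((2\pi)^{p/2}I_{p/2-1}(\kappa)\big)$. $D_{\mathrm{KL}}(P\|Q)$ is the Kullback–Leibler divergence. The InfoNCE losses are $$L^{\mathrm{div}}_{i,\mathrm{InfoNCE}}=-\log\frac{e^{\mathrm{sim}_{\mathrm{div}}(\mathcal{D}_i,\mathcal{D}_i^+)}}{e^{\mathrm{sim}_{\mathrm{div}}(\mathcal{D}_i,\mathcal{D}_i^+)}+\sum_{j\neq i}^{K}e^{\mathrm{sim}_{\mathrm{div}}(\mathcal{D}_i,\mathcal{D}_j)}},\qquad L^{\mathrm{cos}}_{i,\mathrm{InfoNCE}}=-\log\frac{e^{\mathrm{sim}_{\mathrm{cos}}(z_i,z_i^+)/\tau}}{e^{\mathrm{sim}_{\mathrm{cos}}(z_i,z_i^+)/\tau}+\sum_{j\neq i}^{K}e^{\mathrm{sim}_{\mathrm{cos}}(z_i,z_j)/\tau}},$$ where $\mathcal{D}_i=\mathcal{D}(z_i)$, $\mathcal{D}_i^+=\mathcal{D}(z_i^+)$, $\mathcal{D}_j=\mathcal{D}(z_j)$.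 *)

theory Defs
  imports "HOL-Probability.Probability"
begin

definition bessel_I :: "real \<Rightarrow> real \<Rightarrow> real" where
  "bessel_I nu x = (\<Sum>k. (x / 2) powr (2 * real k + nu) / (fact k * Gamma (real k + nu + 1)))"

definition bessel_ratio_A :: "nat \<Rightarrow> real \<Rightarrow> real" where
  "bessel_ratio_A p kappa = bessel_I (real p / 2) kappa / bessel_I (real p / 2 - 1) kappa"

definition vmf_const :: "nat \<Rightarrow> real \<Rightarrow> real" where
  "vmf_const p kappa = kappa powr (real p / 2 - 1) /
      ((2 * pi) powr (real p / 2) * bessel_I (real p / 2 - 1) kappa)"

text \<open>Surface measure on the unit sphere of a Euclidean space of dimension p = DIM('a),
  given as the cone measure: sigma(A) = p * lambda({r x. 0 < r <= 1, x in A}), i.e. p times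
  the push-forward of Lebesgue measure on the punctured unit ball under radial projection.\<close>
definition sphere_measure :: "'a::euclidean_space measure" where
  "sphere_measure = scale_measure (of_nat DIM('a))
     (distr (restrict_space lborel (ball 0 1 - {0})) (restrict_space borel (sphere 0 1))
        (\<lambda>x. x /\<^sub>R norm x))"

definition vMF :: "'a::euclidean_space \<Rightarrow> real \<Rightarrow> 'a measure" where
  "vMF mu kappa = density sphere_measure
     (\<lambda>x. ennreal (vmf_const DIM('a) kappa * exp (kappa * (mu \<bullet> x))))"

text \<open>D_KL(P || Q) with natural logarithm.  Note the library's KL_divergence b M N is
  the divergence of N relative to M.\<close>
definition KL :: "'a measure \<Rightarrow> 'a measure \<Rightarrow> real" where
  "KL P Q = KL_divergence (exp 1) Q P"

definition sim_cos :: "'a::real_inner \<Rightarrow> 'a \<Rightarrow> real" where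
  "sim_cos x y = x \<bullet> y"

definition sim_div :: "'a measure \<Rightarrow> 'a measure \<Rightarrow> real" where
  "sim_div P Q = - KL P Q"

definition infoNCE :: "('x \<Rightarrow> 'x \<Rightarrow> real) \<Rightarrow> 'x \<Rightarrow> 'x \<Rightarrow> ('j \<Rightarrow> 'x) \<Rightarrow> 'j set \<Rightarrow> real" where
  "infoNCE s a b n J = - ln (exp (s a b) / (exp (s a b) + (\<Sum>j\<in>J. exp (s a (n j)))))"

end

theory Submission
  imports Defs
begin

text \<open>The Kullback--Leibler divergence of two vMF distributions with equal concentration is linear in
  the mean: it equals \<open>\<kappa> (z - w) \<bullet> E x\<close>, where \<open>x\<close> has mean direction \<open>z\<close>. Invariance of the surface
  measure under reflections gives \<open>E x = A z\<close> for a scalar \<open>A\<close>, so the divergence is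
  \<open>\<kappa> A (1 - z \<bullet> w)\<close>, and the constant \<open>- \<kappa> A\<close> cancels in the softmax of InfoNCE. The scalar is
  the Bessel ratio: by symmetry \<open>exp (\<kappa> t) t\<close> may be replaced by \<open>t sinh (\<kappa> t)\<close>, whose power series is
  integrated termwise, the even moments of the sphere being obtained from a Gaussian integral evaluated
  both in polar and in Cartesian coordinates.\<close>

section \<open>Invariance of Lebesgue and surface measure\<close>

text \<open>The convolution \<open>\<integral>\<integral> 1\<^sub>B(y) 1\<^sub>A(x + y)\<close> is evaluated in both orders of integration; the
  symmetry of the ball absorbs the reflection that this produces.\<close>
lemma translation_invariant_eq_lborel:
  fixes M :: "'a::euclidean_space measure"
  assumes [measurable_cong, simp]: "sets M = sets borel" and "sigma_finite_measure M"
    and trans: "\<And>c. distr M borel ((+) c) = M"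
    and ball: "emeasure M (ball 0 1) = emeasure lborel (ball 0 1 :: 'a set)"
  shows "M = lborel"
proof (rule measure_eqI)
  interpret M: sigma_finite_measure M by fact
  interpret P: pair_sigma_finite M "lborel :: 'a measure" ..
  let ?B = "ball 0 1 :: 'a set"
  have Bm [measurable, simp]: "(indicator ?B :: 'a \<Rightarrow> ennreal) \<in> borel_measurable borel"
    by (intro borel_measurable_indicator) simp
  have shiftM: "(\<integral>\<^sup>+x. f (c + x) \<partial>M) = (\<integral>\<^sup>+x. f x \<partial>M)"
    if [measurable]: "f \<in> borel_measurable borel" for f :: "'a \<Rightarrow> ennreal" and c
    by (subst (2) trans[of c, symmetric]) (simp add: nn_integral_distr)
  have shiftL: "(\<integral>\<^sup>+x. f (c + x) \<partial>lborel) = (\<integral>\<^sup>+x. f x \<partial>lborel)"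
    if [measurable]: "f \<in> borel_measurable borel" for f :: "'a \<Rightarrow> ennreal" and c
    by (subst (2) lborel_distr_plus[of c, symmetric]) (simp add: nn_integral_distr)
  fix A assume "A \<in> sets M"
  then have [measurable, simp]: "A \<in> sets borel" by simp
  have "emeasure lborel ?B * emeasure M A
      = (\<integral>\<^sup>+y. indicator ?B y * (\<integral>\<^sup>+x. indicator A x \<partial>M) \<partial>lborel)"
    by (subst nn_integral_multc) simp_all
  also have "\<dots> = (\<integral>\<^sup>+y. \<integral>\<^sup>+x. indicator ?B y * indicator A (y + x) \<partial>M \<partial>lborel)"
    by (simp add: nn_integral_cmult shiftM)
  also have "\<dots> = (\<integral>\<^sup>+x. \<integral>\<^sup>+y. indicator ?B y * indicator A (y + x) \<partial>lborel \<partial>M)"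
    by (rule P.Fubini') measurable
  also have "\<dots> = (\<integral>\<^sup>+x. \<integral>\<^sup>+y. indicator ?B (y - x) * indicator A y \<partial>lborel \<partial>M)"
  proof (rule nn_integral_cong)
    fix x :: 'a
    show "(\<integral>\<^sup>+y. indicator ?B y * indicator A (y + x) \<partial>lborel)
        = (\<integral>\<^sup>+y. indicator ?B (y - x) * indicator A y \<partial>lborel)"
      by (subst shiftL[of _ "- x", symmetric]) simp_all
  qed
  also have "\<dots> = (\<integral>\<^sup>+y. \<integral>\<^sup>+x. indicator ?B (y - x) * indicator A y \<partial>M \<partial>lborel)"
    by (rule P.Fubini'[symmetric]) measurable
  also have "\<dots> = (\<integral>\<^sup>+y. emeasure M ?B * indicator A y \<partial>lborel)"
  proof (rule nn_integral_cong)
    fix y :: 'a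
    have "(\<integral>\<^sup>+x. indicator ?B (y - x) * indicator A y \<partial>M)
        = (\<integral>\<^sup>+x. indicator ?B (y - x) \<partial>M) * indicator A y"
      by (simp add: nn_integral_multc)
    also have "(\<integral>\<^sup>+x. indicator ?B (y - x) \<partial>M) = (\<integral>\<^sup>+x. indicator ?B (- x) \<partial>M)"
      by (subst shiftM[of _ y, symmetric]) simp_all
    also have "\<dots> = (\<integral>\<^sup>+x. indicator ?B x \<partial>M)"
      by (intro nn_integral_cong) (simp split: split_indicator)
    finally show "(\<integral>\<^sup>+x. indicator ?B (y - x) * indicator A y \<partial>M) = emeasure M ?B * indicator A y"
      by simp
  qed
  also have "\<dots> = emeasure lborel ?B * emeasure lborel A"
    by (simp add: nn_integral_cmult ball)
  \<comment> \<open>The factor cancels because the unit ball has finite, nonzero volume.\<close>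
  finally show "emeasure M A = emeasure lborel A"
    using emeasure_lborel_ball_finite[of "0::'a" 1] content_ball_pos[of 1 "0::'a"]
    by (auto simp: ennreal_mult_cancel_left measure_def)
qed simp

lemma measurable_orthogonal_transformation:
  fixes T :: "'a::euclidean_space \<Rightarrow> 'a"
  assumes "orthogonal_transformation T"
  shows "T \<in> borel_measurable borel"
  using orthogonal_transformation_linear[OF assms]
  by (intro borel_measurable_continuous_onI linear_continuous_on linear_conv_bounded_linear[THEN iffD1])

text \<open>The image measure is translation invariant because \<open>T\<close> is linear and onto,
  and it keeps the volume of the unit ball because \<open>T\<close> preserves norms; these two
  properties characterise Lebesgue measure.\<close>

lemma lborel_distr_orthogonal_transformation:
  fixes T :: "'a::euclidean_space \<Rightarrow> 'a"
  assumes T: "orthogonal_transformation T"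
  shows "distr lborel borel T = lborel"
proof (rule translation_invariant_eq_lborel)
  have lin: "linear T" using T by (rule orthogonal_transformation_linear)
  have [measurable]: "T \<in> borel_measurable borel"
    by (rule measurable_orthogonal_transformation[OF T])
  have nT: "norm (T x) = norm x" for x using T by (rule orthogonal_transformation_norm)
  have ball: "T -` ball 0 r = ball 0 r" for r by (auto simp: nT)
  show "emeasure (distr lborel borel T) (ball 0 1) = emeasure lborel (ball 0 1 :: 'a set)"
    by (simp add: emeasure_distr ball)
  show "sigma_finite_measure (distr lborel borel T)"
  proof
    show "\<exists>A. countable A \<and> A \<subseteq> sets (distr lborel borel T) \<and>
      \<Union> A = space (distr lborel borel T) \<and> (\<forall>a\<in>A. emeasure (distr lborel borel T) a \<noteq> \<infinity>)"
    proof (intro exI[of _ "range (\<lambda>n::nat. ball (0::'a) (real n))"] conjI ballI)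
      show "\<Union> (range (\<lambda>n::nat. ball (0::'a) (real n))) = space (distr lborel borel T)"
        by (auto simp: reals_Archimedean2)
    next
      fix a assume "a \<in> range (\<lambda>n::nat. ball (0::'a) (real n))"
      then obtain n where a: "a = ball 0 (real n)" by auto
      show "emeasure (distr lborel borel T) a \<noteq> \<infinity>"
        using emeasure_lborel_ball_finite[of "0::'a" "real n"] by (simp add: a emeasure_distr ball)
    qed auto
  qed
  fix c
  \<comment> \<open>Translating by \<open>c\<close> after \<open>T\<close> is the same as
    translating by a preimage \<open>d\<close> of \<open>c\<close> before \<open>T\<close>.\<close>
  obtain d where d: "T d = c" 
    using orthogonal_transformation_surj[OF T] by (metis surjD)
  have "distr (distr lborel borel T) borel ((+) c) = distr (distr lborel borel ((+) d)) borel T"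
    by (simp add: distr_distr o_def linear_add[OF lin] d)
  then show "distr (distr lborel borel T) borel ((+) c) = distr lborel borel T"
    by (simp add: lborel_distr_plus)
qed simp

section \<open>The cone measure on the sphere\<close>

lemma space_sphere_measure [simp]: "space (sphere_measure :: 'a::euclidean_space measure) = sphere 0 1"
  by (simp add: sphere_measure_def space_scale_measure space_restrict_space)

lemma sets_sphere_measure [measurable_cong, simp]:
  "sets (sphere_measure :: 'a::euclidean_space measure) = sets (restrict_space borel (sphere 0 1))"
  by (simp add: sphere_measure_def)

lemma borel_measurable_sphere_measure [measurable (raw)]:
  "f \<in> borel_measurable borel \<Longrightarrow> f \<in> borel_measurable (sphere_measure :: 'a::euclidean_space measure)"
  by (subst measurable_cong_sets[OF sets_sphere_measure refl]) (rule measurable_restrict_space1)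

lemma nn_integral_sphere_measure:
  fixes g :: "'a::euclidean_space \<Rightarrow> ennreal"
  assumes [measurable]: "g \<in> borel_measurable (restrict_space borel (sphere 0 1))"
  shows "(\<integral>\<^sup>+x. g x \<partial>sphere_measure)
    = DIM('a) * (\<integral>\<^sup>+x. g (x /\<^sub>R norm x) * indicator (ball 0 1 - {0}) x \<partial>lborel)"
proof -
  have [measurable]: "(\<lambda>x::'a. x /\<^sub>R norm x)
      \<in> restrict_space lborel (ball 0 1 - {0}) \<rightarrow>\<^sub>M restrict_space borel (sphere 0 1)"
    by (intro measurable_restrict_space2 measurable_restrict_space1)
      (auto simp: space_restrict_space)
  show ?thesis
    by (simp add: sphere_measure_def nn_integral_scale_measure nn_integral_distr
      nn_integral_restrict_space)
qed

lemma measurable_orthogonal_transformation_sphere_measure: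
  fixes T :: "'a::euclidean_space \<Rightarrow> 'a"
  assumes "orthogonal_transformation T"
  shows "T \<in> sphere_measure \<rightarrow>\<^sub>M sphere_measure"
proof -
  have "T \<in> restrict_space borel (sphere 0 1) \<rightarrow>\<^sub>M restrict_space borel (sphere 0 1)"
    using measurable_orthogonal_transformation[OF assms]
    by (intro measurable_restrict_space2 measurable_restrict_space1)
      (auto simp: space_restrict_space orthogonal_transformation_norm[OF assms])
  then show ?thesis by (simp cong: measurable_cong_sets)
qed

text \<open>An orthogonal map commutes with radial projection and preserves the punctured ball, so
  the cone measure inherits the invariance of Lebesgue measure.\<close>

lemma sphere_measure_distr_orthogonal_transformation:
  fixes T :: "'a::euclidean_space \<Rightarrow> 'a"
  assumes T: "orthogonal_transformation T"
  shows "distr sphere_measure sphere_measure T = sphere_measure"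
proof (rule measure_eqI)
  have lin: "linear T" using T by (rule orthogonal_transformation_linear)
  have [measurable]: "T \<in> borel_measurable borel"
    by (rule measurable_orthogonal_transformation[OF T])
  have nT: "norm (T x) = norm x" for x using T by (rule orthogonal_transformation_norm)
  have T0: "T x = 0 \<longleftrightarrow> x = 0" for x using nT[of x] by (metis norm_eq_zero)
  have [measurable]: "T \<in> sphere_measure \<rightarrow>\<^sub>M sphere_measure"
    by (rule measurable_orthogonal_transformation_sphere_measure[OF T])
  then have [measurable]: "T \<in> restrict_space borel (sphere 0 1) \<rightarrow>\<^sub>M restrict_space borel (sphere 0 1)"
    by (simp cong: measurable_cong_sets)
  fix A assume "A \<in> sets (distr sphere_measure sphere_measure T)"
  then have A[measurable]: "A \<in> sets (restrict_space borel (sphere 0 1))" by simp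
  then have A'[measurable]: "A \<in> sets borel"
    by (auto simp: sets_restrict_space)
  have [measurable]: "(\<lambda>x. indicator A (x /\<^sub>R norm x) * indicator (ball 0 1 - {0}) x :: ennreal) \<in> borel_measurable borel"
    by (intro borel_measurable_times_ennreal borel_measurable_indicator) measurable
  have "emeasure (distr sphere_measure sphere_measure T) A
    = (\<integral>\<^sup>+x. indicator A x \<partial>distr sphere_measure sphere_measure T)"
    by (rule nn_integral_indicator[symmetric]) simp
  also have "\<dots> = (\<integral>\<^sup>+x. indicator A (T x) \<partial>sphere_measure)"
    by (rule nn_integral_distr) measurable
  also have "\<dots> = DIM('a) * (\<integral>\<^sup>+x. indicator A (T x /\<^sub>R norm (T x)) * indicator (ball 0 1 - {0}) (T x) \<partial>lborel)"
    by (subst nn_integral_sphere_measure)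
      (simp_all add: linear_scale[OF lin] nT T0 indicator_def)
  also have "\<dots> = DIM('a) * (\<integral>\<^sup>+x. indicator A (x /\<^sub>R norm x) * indicator (ball 0 1 - {0}) x \<partial>distr lborel borel T)"
    by (subst nn_integral_distr) simp_all
  also have "\<dots> = (\<integral>\<^sup>+x. indicator A x \<partial>sphere_measure)"
    by (simp add: lborel_distr_orthogonal_transformation[OF T] nn_integral_sphere_measure del: nn_integral_indicator)
  finally show "emeasure (distr sphere_measure sphere_measure T) A = emeasure sphere_measure A"
    by simp
qed simp

lemma finite_measure_sphere_measure: "finite_measure (sphere_measure :: 'a::euclidean_space measure)"
proof
  have "emeasure sphere_measure (space (sphere_measure :: 'a measure))
      = (\<integral>\<^sup>+x. 1 \<partial>(sphere_measure :: 'a measure))"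
    by simp
  also have "\<dots> = DIM('a) * emeasure lborel (ball 0 1 - {0} :: 'a set)"
    by (subst nn_integral_sphere_measure) simp_all
  also have "\<dots> \<le> DIM('a) * emeasure lborel (ball 0 1 :: 'a set)"
    by (intro mult_left_mono emeasure_mono) auto
  also have "\<dots> < \<infinity>"
    using emeasure_lborel_ball_finite[of "0::'a" 1] by (simp add: ennreal_mult_less_top of_nat_less_top)
  finally show "emeasure sphere_measure (space (sphere_measure :: 'a measure)) \<noteq> \<infinity>" by simp
qed

section \<open>Polar coordinates and Gaussian moments\<close>

lemma nn_integral_lborel_scaleR:
  fixes f :: "'a::euclidean_space \<Rightarrow> ennreal"
  assumes [measurable]: "f \<in> borel_measurable borel" and "c > 0"
  shows "(\<integral>\<^sup>+x. f x \<partial>lborel) = ennreal (c ^ DIM('a)) * (\<integral>\<^sup>+x. f (c *\<^sub>R x) \<partial>lborel)"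
  using \<open>c > 0\<close>
  by (subst lborel_affine[of c 0])
    (simp_all add: nn_integral_density nn_integral_distr nn_integral_cmult)

text \<open>The radial mass below \<open>t\<close>, in the shape of the density met in
  \<open>nn_integral_polar\<close>; both endpoints are null.\<close>

lemma nn_integral_power_lessThan:
  fixes t :: real
  assumes "n > 0" "t > 0"
  shows "(\<integral>\<^sup>+r. ennreal (r ^ (n - 1)) * indicator {0<..} r * indicator {..<t} r \<partial>lborel)
    = ennreal (t ^ n / n)"
proof -
  have "(\<integral>\<^sup>+r. ennreal (r ^ (n - 1)) * indicator {0<..} r * indicator {..<t} r \<partial>lborel)
      = (\<integral>\<^sup>+r. ennreal (r ^ (n - 1)) * indicator {0..t} r \<partial>lborel)"
    using AE_lborel_singleton[of 0] AE_lborel_singleton[of t]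
    by (intro nn_integral_cong_AE, eventually_elim) (auto split: split_indicator)
  also have "\<dots> = ennreal (t ^ n / n - 0 ^ n / n)"
    using assms by (intro nn_integral_FTC_Icc) (auto intro!: derivative_eq_intros)
  finally show ?thesis using assms by (simp add: power_0_left)
qed

text \<open>Two measures on the line are compared: the image under \<open>norm\<close> of Lebesgue
  measure weighted by the angular factor, and the radial density scaled by the total angular mass.
  By homogeneity their values on \<open>{..<t}\<close> reduce to the unit ball, where the cone
  measure makes them agree; such half-lines generate the Borel sets.\<close>

theorem nn_integral_polar:
  fixes g :: "'a::euclidean_space \<Rightarrow> ennreal" and \<phi> :: "real \<Rightarrow> ennreal"
  assumes [measurable]: "g \<in> borel_measurable borel" "\<phi> \<in> borel_measurable borel"
    and fin: "(\<integral>\<^sup>+x. g x \<partial>sphere_measure) < \<infinity>"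
  shows "(\<integral>\<^sup>+x. \<phi> (norm x) * g (x /\<^sub>R norm x) \<partial>lborel)
    = (\<integral>\<^sup>+x. g x \<partial>sphere_measure)
      * (\<integral>\<^sup>+r. \<phi> r * (ennreal (r ^ (DIM('a) - 1)) * indicator {0<..} r) \<partial>lborel)"
proof -
  define G where "G = (\<integral>\<^sup>+x. g x \<partial>sphere_measure)"
  define M where "M = distr (density lborel (\<lambda>x. g (x /\<^sub>R norm x))) borel norm"
  define N where "N = density lborel (\<lambda>r. G * (ennreal (r ^ (DIM('a) - 1)) * indicator {0<..} r))"
  have G: "G = DIM('a) * (\<integral>\<^sup>+x. g (x /\<^sub>R norm x) * indicator (ball 0 1) x \<partial>lborel)"
  proof -
    have "(\<integral>\<^sup>+x. g (x /\<^sub>R norm x) * indicator (ball 0 1 - {0}) x \<partial>lborel)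
        = (\<integral>\<^sup>+x. g (x /\<^sub>R norm x) * indicator (ball 0 1) x \<partial>lborel)"
      using AE_lborel_singleton[of 0]
      by (intro nn_integral_cong_AE, eventually_elim) (auto split: split_indicator)
    then show ?thesis
      unfolding G_def by (subst nn_integral_sphere_measure) (auto intro: measurable_restrict_space1)
  qed
  have eq: "emeasure M {..<t} = G * ennreal (t ^ DIM('a) / DIM('a)) \<and>
            emeasure N {..<t} = G * ennreal (t ^ DIM('a) / DIM('a))" if "t > 0" for t
  proof
    have "emeasure M {..<t} = (\<integral>\<^sup>+x. g (x /\<^sub>R norm x) * indicator {..<t} (norm x) \<partial>lborel)"
      by (subst nn_integral_indicator[symmetric])
        (simp_all add: M_def nn_integral_distr nn_integral_density del: nn_integral_indicator)
    \<comment> \<open>Dilation by \<open>t\<close> carries the ball of radius \<open>t\<close> back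
      to the unit ball and leaves the direction \<open>x /\<^sub>R norm x\<close> unchanged.\<close>
    also have "\<dots> = ennreal (t ^ DIM('a)) *
      (\<integral>\<^sup>+x. g ((t *\<^sub>R x) /\<^sub>R norm (t *\<^sub>R x)) * indicator {..<t} (norm (t *\<^sub>R x)) \<partial>lborel)"
      using that by (subst nn_integral_lborel_scaleR[of _ t]) simp_all
    also have "(\<lambda>x. g ((t *\<^sub>R x) /\<^sub>R norm (t *\<^sub>R x)) * indicator {..<t} (norm (t *\<^sub>R x)))
      = (\<lambda>x::'a. g (x /\<^sub>R norm x) * indicator (ball 0 1) x)"
    proof
      fix x :: 'a
      have *: "(t *\<^sub>R x) /\<^sub>R norm (t *\<^sub>R x) = x /\<^sub>R norm x"
        using that by (cases "x = 0") (simp_all add: field_simps)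
      show "g ((t *\<^sub>R x) /\<^sub>R norm (t *\<^sub>R x)) * indicator {..<t} (norm (t *\<^sub>R x))
          = g (x /\<^sub>R norm x) * indicator (ball 0 1) x"
        unfolding * using that by (simp add: indicator_def)
    qed
    also have "ennreal (t ^ DIM('a)) * (\<integral>\<^sup>+x. g (x /\<^sub>R norm x) * indicator (ball 0 1) x \<partial>lborel)
      = G * ennreal (t ^ DIM('a) / DIM('a))"
    proof -
      have "ennreal (t ^ DIM('a)) = of_nat DIM('a) * ennreal (t ^ DIM('a) / DIM('a))"
        using that by (subst ennreal_of_nat_eq_real_of_nat) (simp add: ennreal_mult[symmetric])
      then show ?thesis by (simp add: G mult_ac)
    qed
    finally show "emeasure M {..<t} = G * ennreal (t ^ DIM('a) / DIM('a))" .
    have "emeasure N {..<t} = G * (\<integral>\<^sup>+r. ennreal (r ^ (DIM('a) - 1)) * indicator {0<..} r * indicator {..<t} r \<partial>lborel)"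
      by (simp add: N_def emeasure_density mult.assoc nn_integral_cmult)
    then show "emeasure N {..<t} = G * ennreal (t ^ DIM('a) / DIM('a))"
      by (simp only: nn_integral_power_lessThan[OF DIM_positive that])
  qed
  have eq0: "emeasure M {..<t} = emeasure N {..<t}" if "t \<le> 0" for t
  proof -
    have "emeasure M {..<t} = 0"
    proof -
      have "norm -` {..<t} = ({} :: 'a set)" by (auto dest!: less_le_trans[OF _ that])
      then show ?thesis by (simp add: M_def emeasure_distr)
    qed
    moreover have "emeasure N {..<t} = (\<integral>\<^sup>+r. 0 \<partial>(lborel :: real measure))"
      unfolding N_def using that
      by (subst emeasure_density) (auto intro!: nn_integral_cong simp del: nn_integral_const split: split_indicator)
    ultimately show ?thesis by simp
  qed
  \<comment> \<open>Half-lines are closed under intersection. The hypothesis \<open>fin\<close>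
    makes the exhausting half-lines have finite mass, as uniqueness of the extension
    requires.\<close>
  have "M = N"
  proof (rule measure_eqI_generator_eq)
    show "Int_stable (range lessThan :: real set set)"
      by (rule Int_stableI) (auto simp: image_iff intro: exI[of _ "min _ _"])
    show "emeasure M X = emeasure N X" if "X \<in> range lessThan" for X
    proof -
      from that obtain t where "X = {..<t}" by auto
      then show ?thesis using eq[of t] eq0[of t] by (cases "t > 0") auto
    qed
    show "sets M = sigma_sets UNIV (range lessThan)" "sets N = sigma_sets UNIV (range lessThan)"
      by (simp_all add: M_def N_def borel_Iio)
    show "range (\<lambda>i::nat. {..<real (Suc i)}) \<subseteq> range lessThan" by auto
    show "(\<Union>i. {..<real (Suc i)}) = UNIV"
    proof (intro equalityI subsetI UN_I UNIV_I)
      fix x :: real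
      show "x \<in> {..<real (Suc (nat \<lceil>x\<rceil>))}"
        by simp linarith
    qed
    show "emeasure M {..<real (Suc i)} \<noteq> \<infinity>" for i
      using eq[of "real (Suc i)"] fin by (simp add: G_def[symmetric] ennreal_mult_eq_top_iff del: of_nat_Suc)
  qed simp
  have "(\<integral>\<^sup>+x. \<phi> (norm x) * g (x /\<^sub>R norm x) \<partial>lborel) = (\<integral>\<^sup>+r. \<phi> r \<partial>M)"
    by (simp add: M_def nn_integral_distr nn_integral_density mult.commute)
  also have "\<dots> = (\<integral>\<^sup>+r. G * (\<phi> r * (ennreal (r ^ (DIM('a) - 1)) * indicator {0<..} r)) \<partial>lborel)"
    unfolding \<open>M = N\<close> by (simp add: N_def nn_integral_density mult_ac)
  also have "\<dots> = G * (\<integral>\<^sup>+r. \<phi> r * (ennreal (r ^ (DIM('a) - 1)) * indicator {0<..} r) \<partial>lborel)"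
    by (rule nn_integral_cmult) measurable
  finally show ?thesis by (simp add: G_def)
qed

section \<open>Gaussian integrals in one and several variables\<close>

text \<open>Turns the factorial quotient of the even Gaussian moments into a Gamma value, so that
  moments of both parities share one formula.\<close>

lemma Gamma_nat_plus_half:
  "Gamma (real k + 1 / 2) = sqrt pi * fact (2 * k) / (2 ^ (2 * k) * fact k)"
proof (induction k)
  case 0
  then show ?case by (simp add: Gamma_one_half_real)
next
  case (Suc k)
  have "Gamma (real (Suc k) + 1 / 2) = (real k + 1 / 2) * Gamma (real k + 1 / 2)"
    using Gamma_plus1[of "real k + 1 / 2"] nonpos_Ints_nonpos[of "real k + 1 / 2"]
    by (force simp: add_ac)
  also have "\<dots> = sqrt pi * fact (2 * Suc k) / (2 ^ (2 * Suc k) * fact (Suc k))"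
  proof -
    have "(x + 1 / 2) * (s * F / (P * K)) = s * (2 * (x + 1) * (2 * x + 1) * F) / (4 * P * ((x + 1) * K))"
      if "x \<ge> 0" for x s F P K :: real
      using that by (simp add: divide_simps) algebra
    from this[of "real k" "sqrt pi" "fact (2 * k)" "2 ^ (2 * k)" "fact k"]
    show ?thesis unfolding Suc by (simp add: algebra_simps)
  qed
  finally show ?case .
qed

text \<open>The radial integral of polar coordinates. Its exponent will be
  \<open>2 * m + DIM('a) - 1\<close>, whose parity depends on the dimension, so both parities are
  covered.\<close>

lemma nn_integral_power_gaussian_pos:
  "(\<integral>\<^sup>+r. ennreal (r ^ q * exp (- r\<^sup>2)) * indicator {0<..} r \<partial>lborel)
    = ennreal (Gamma ((real q + 1) / 2) / 2)"
proof -
  have "has_bochner_integral lborel (\<lambda>x::real. indicator {0..} x *\<^sub>R (exp (-x\<^sup>2) * x ^ q))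
     (Gamma ((real q + 1) / 2) / 2)"
  proof (cases "even q")
    case True
    then obtain k where q: "q = 2 * k" by (auto elim: evenE)
    have "Gamma ((real q + 1) / 2) = Gamma (real k + 1 / 2)" by (simp add: q add_divide_distrib)
    then show ?thesis
      using gaussian_moment_even_pos[of k] by (simp add: q Gamma_nat_plus_half ac_simps)
  next
    case False
    then obtain k where q: "q = 2 * k + 1" by (auto elim: oddE)
    have "Gamma ((real q + 1) / 2) = Gamma (1 + real k)" by (simp add: q add_divide_distrib add_ac)
    then show ?thesis
      using gaussian_moment_odd_pos[of k] by (simp add: q Gamma_fact)
  qed
  then have "(\<integral>\<^sup>+r. ennreal (indicator {0..} r *\<^sub>R (exp (-r\<^sup>2) * r ^ q)) \<partial>lborel)
      = ennreal (Gamma ((real q + 1) / 2) / 2)"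
    by (simp add: has_bochner_integral_iff nn_integral_eq_integral indicator_def)
  also have "(\<integral>\<^sup>+r. ennreal (indicator {0..} r *\<^sub>R (exp (-r\<^sup>2) * r ^ q)) \<partial>lborel)
      = (\<integral>\<^sup>+r. ennreal (r ^ q * exp (- r\<^sup>2)) * indicator {0<..} r \<partial>lborel)"
    using AE_lborel_singleton[of 0]
    by (intro nn_integral_cong_AE, eventually_elim) (auto split: split_indicator simp: mult.commute)
  finally show ?thesis .
qed

lemma nn_integral_even_power_gaussian:
  "(\<integral>\<^sup>+r. ennreal (r ^ (2 * m) * exp (- r\<^sup>2)) \<partial>lborel) = ennreal (Gamma (real m + 1 / 2))"
proof -
  have "has_bochner_integral lborel (\<lambda>x::real. x ^ (2 * m) * exp (-x\<^sup>2)) (Gamma (real m + 1 / 2))"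
    using has_bochner_integral_even_function[OF gaussian_moment_even_pos[of m]]
    by (simp add: Gamma_nat_plus_half mult.commute)
  then show ?thesis
    by (subst nn_integral_eq_integral) (auto simp: has_bochner_integral_iff zero_le_even_power)
qed

text \<open>The Gaussian factors over the coordinates: the one along \<open>e\<close> carries the
  power, and each of the others contributes \<open>sqrt pi\<close>.\<close>

lemma nn_integral_coordinate_gaussian:
  fixes e :: "'a::euclidean_space"
  assumes e: "e \<in> Basis"
  shows "(\<integral>\<^sup>+x. ennreal ((e \<bullet> x) ^ (2 * m) * exp (- (norm x)\<^sup>2)) \<partial>lborel)
    = ennreal (Gamma (real m + 1 / 2) * sqrt pi ^ (DIM('a) - 1))"
proof -
  let ?m = "\<lambda>b. if b = e then m else 0"
  have "ennreal ((e \<bullet> x) ^ (2 * m) * exp (- (norm x)\<^sup>2))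
      = (\<Prod>b\<in>Basis. ennreal ((x \<bullet> b) ^ (2 * ?m b) * exp (- (x \<bullet> b)\<^sup>2)))" for x
  proof -
    have "(norm x)\<^sup>2 = (\<Sum>b\<in>Basis. (x \<bullet> b)\<^sup>2)"
      unfolding power2_norm_eq_inner by (subst euclidean_inner) (simp add: power2_eq_square)
    moreover have "(\<Prod>b\<in>Basis. (x \<bullet> b) ^ (2 * ?m b)) = (\<Prod>b\<in>Basis. if b = e then (e \<bullet> x) ^ (2 * m) else 1)"
      by (intro prod.cong) (auto simp: inner_commute)
    ultimately show ?thesis
      using e by (simp add: prod_ennreal prod.distrib exp_sum sum_negf[symmetric])
  qed
  then have "(\<integral>\<^sup>+x. ennreal ((e \<bullet> x) ^ (2 * m) * exp (- (norm x)\<^sup>2)) \<partial>lborel)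
      = (\<Prod>b\<in>(Basis::'a set). \<integral>\<^sup>+r. ennreal (r ^ (2 * ?m b) * exp (- r\<^sup>2)) \<partial>lborel)"
    by (simp only:) (rule nn_integral_lborel_prod, measurable)
  also have "\<dots> = (\<Prod>b\<in>(Basis::'a set). ennreal (if b = e then Gamma (real m + 1 / 2) else sqrt pi))"
    unfolding nn_integral_even_power_gaussian
    by (intro prod.cong) (auto simp: Gamma_one_half_real)
  also have "\<dots> = ennreal (Gamma (real m + 1 / 2) * sqrt pi ^ (DIM('a) - 1))"
    using e by (subst prod_ennreal) (auto simp: prod.If_cases Gamma_real_pos less_imp_le Diff_eq[symmetric]
       prod.remove[of Basis e])
  finally show ?thesis .
qed

section \<open>Moments of the sphere\<close>

text \<open>The witness is the Householder reflection in the hyperplane orthogonal to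
  \<open>a - b\<close>.\<close>

lemma orthogonal_transformation_exists_euclidean:
  fixes a b :: "'a::euclidean_space"
  assumes "norm a = norm b"
  obtains T where "orthogonal_transformation T" "T a = b"
proof (cases "a = b")
  case True
  with that[OF orthogonal_transformation_id] show ?thesis by simp
next
  case False
  define u where "u = a - b"
  define T where "T x = x - (2 * (u \<bullet> x) / (u \<bullet> u)) *\<^sub>R u" for x
  have u: "u \<bullet> u \<noteq> 0" using False by (simp add: u_def)
  have "linear T"
    by (rule linearI) (simp_all add: T_def inner_add_right add_divide_distrib algebra_simps)
  moreover have "T x \<bullet> T y = x \<bullet> y" for x y
    using u by (simp add: T_def inner_diff_left inner_diff_right inner_commute field_simps)
  moreover have "T a = b"
  proof -
    \<comment> \<open>Equality of the norms makes the reflection coefficient at \<open>a\<close>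
      equal to 1, so that \<open>T a\<close> is \<open>a - u\<close>.\<close>
    have "u \<bullet> u = 2 * (u \<bullet> a)"
      using assms by (simp add: u_def norm_eq inner_diff_left inner_diff_right inner_commute)
    then show ?thesis using u by (simp add: T_def u_def)
  qed
  ultimately show ?thesis using that[of T] by (simp add: orthogonal_transformation_def)
qed

lemma integral_sphere_measure_orthogonal_transformation:
  fixes T :: "'a::euclidean_space \<Rightarrow> 'a" and f :: "'a \<Rightarrow> real"
  assumes T: "orthogonal_transformation T" and [measurable]: "f \<in> borel_measurable borel"
  shows "(\<integral>x. f (T x) \<partial>sphere_measure) = (\<integral>x. f x \<partial>sphere_measure)"
  by (subst (2) sphere_measure_distr_orthogonal_transformation[OF T, symmetric])
    (simp add: integral_distr measurable_orthogonal_transformation_sphere_measure[OF T])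

lemma nn_integral_sphere_measure_orthogonal_transformation:
  fixes T :: "'a::euclidean_space \<Rightarrow> 'a" and f :: "'a \<Rightarrow> ennreal"
  assumes T: "orthogonal_transformation T" and [measurable]: "f \<in> borel_measurable borel"
  shows "(\<integral>\<^sup>+x. f (T x) \<partial>sphere_measure) = (\<integral>\<^sup>+x. f x \<partial>sphere_measure)"
  by (subst (2) sphere_measure_distr_orthogonal_transformation[OF T, symmetric])
    (simp add: nn_integral_distr measurable_orthogonal_transformation_sphere_measure[OF T])

text \<open>A continuous function is bounded on the compact sphere, whose total mass is
  finite.\<close>

lemma integrable_sphere_measure:
  fixes f :: "'a::euclidean_space \<Rightarrow> real"
  assumes "continuous_on UNIV f"
  shows "integrable sphere_measure f"
proof -
  interpret finite_measure "sphere_measure :: 'a measure" by (rule finite_measure_sphere_measure)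
  have "compact (f ` sphere 0 1)"
    using assms by (intro compact_continuous_image) (auto intro: continuous_on_subset)
  then obtain B where "\<And>x. x \<in> sphere 0 1 \<Longrightarrow> norm (f x) \<le> B"
    by (meson compact_imp_bounded bounded_iff image_eqI)
  then show ?thesis
    using assms by (intro integrable_const_bound[of _ B] AE_I2 borel_measurable_sphere_measure
       borel_measurable_continuous_onI) auto
qed

text \<open>After moving \<open>z\<close> to a basis vector, polar coordinates split the Gaussian
  moment of \<open>nn_integral_coordinate_gaussian\<close> into the wanted spherical moment times a
  radial Gamma integral; dividing gives the moment.\<close>

lemma sphere_measure_even_moment:
  fixes z :: "'a::euclidean_space"
  assumes "norm z = 1"
  shows "(\<integral>\<^sup>+x. ennreal ((z \<bullet> x) ^ (2 * m)) \<partial>sphere_measure)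
    = ennreal (2 * sqrt pi ^ (DIM('a) - 1) * Gamma (real m + 1 / 2) / Gamma (real m + DIM('a) / 2))"
proof -
  define e :: 'a where "e = (SOME b. b \<in> Basis)"
  have e: "e \<in> Basis" unfolding e_def by (rule SOME_Basis)
  define M where "M = (\<integral>x. (e \<bullet> x) ^ (2 * m) \<partial>(sphere_measure :: 'a measure))"
  obtain T where T: "orthogonal_transformation T" "T z = e"
    using orthogonal_transformation_exists_euclidean[of z e] assms e by auto
  have "(\<integral>\<^sup>+x. ennreal ((z \<bullet> x) ^ (2 * m)) \<partial>sphere_measure)
      = (\<integral>\<^sup>+x. ennreal ((e \<bullet> T x) ^ (2 * m)) \<partial>sphere_measure)"
    using T by (simp add: orthogonal_transformation_def flip: T(2))
  also have "\<dots> = (\<integral>\<^sup>+x. ennreal ((e \<bullet> x) ^ (2 * m)) \<partial>sphere_measure)"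
    by (rule nn_integral_sphere_measure_orthogonal_transformation[OF T(1)]) measurable
  finally have z: "(\<integral>\<^sup>+x. ennreal ((z \<bullet> x) ^ (2 * m)) \<partial>sphere_measure)
    = (\<integral>\<^sup>+x. ennreal ((e \<bullet> x) ^ (2 * m)) \<partial>sphere_measure)" .
  \<comment> \<open>Knowing that the moment is a real number supplies the finiteness hypothesis of
    \<open>nn_integral_polar\<close> and allows the final division.\<close>
  have M: "(\<integral>\<^sup>+x. ennreal ((e \<bullet> x) ^ (2 * m)) \<partial>sphere_measure) = ennreal M"
    unfolding M_def
    by (intro nn_integral_eq_integral integrable_sphere_measure continuous_intros AE_I2
      zero_le_even_power) simp
  have G: "Gamma (real m + 1 / 2) > 0" "Gamma (real m + DIM('a) / 2) > 0"
    by (auto intro!: Gamma_real_pos add_nonneg_pos)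
  have "M \<ge> 0" unfolding M_def by (simp add: zero_le_even_power)
  have "ennreal (Gamma (real m + 1 / 2) * sqrt pi ^ (DIM('a) - 1))
      = (\<integral>\<^sup>+x. ennreal ((e \<bullet> x) ^ (2 * m) * exp (- (norm x)\<^sup>2)) \<partial>lborel)"
    using nn_integral_coordinate_gaussian[OF e] by simp
  also have "\<dots> = (\<integral>\<^sup>+x. ennreal (norm x ^ (2 * m) * exp (- (norm x)\<^sup>2))
      * ennreal ((e \<bullet> (x /\<^sub>R norm x)) ^ (2 * m)) \<partial>lborel)"
  proof -
    have "(e \<bullet> x) ^ (2 * m) = norm x ^ (2 * m) * (e \<bullet> (x /\<^sub>R norm x)) ^ (2 * m)" for x :: 'a
    \<comment> \<open>At the origin the direction is 0 by convention; for \<open>m = 0\<close> both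
      sides are 1, otherwise both are 0.\<close>
    proof (cases "x = 0")
      case False
      then have "e \<bullet> x = norm x * (e \<bullet> (x /\<^sub>R norm x))" by simp
      then show ?thesis by (metis power_mult_distrib)
    qed (cases m, simp_all)
    then show ?thesis
      by (intro nn_integral_cong) (simp add: ennreal_mult[symmetric] zero_le_even_power mult_ac)
  qed
  also have "\<dots> = ennreal M * (\<integral>\<^sup>+r. ennreal (r ^ (2 * m) * exp (- r\<^sup>2))
      * (ennreal (r ^ (DIM('a) - 1)) * indicator {0<..} r) \<partial>lborel)"
    using M by (subst nn_integral_polar) auto
  also have "(\<lambda>r. ennreal (r ^ (2 * m) * exp (- r\<^sup>2)) * (ennreal (r ^ (DIM('a) - 1)) * indicator {0<..} r))
      = (\<lambda>r. ennreal (r ^ (2 * m + DIM('a) - 1) * exp (- r\<^sup>2)) * indicator {0<..} r)"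
  proof
    fix r :: real
    have "r ^ (2 * m + DIM('a) - 1) = r ^ (2 * m) * r ^ (DIM('a) - 1)"
      using DIM_positive[where 'a='a] by (simp flip: power_add)
    then show "ennreal (r ^ (2 * m) * exp (- r\<^sup>2)) * (ennreal (r ^ (DIM('a) - 1)) * indicator {0<..} r)
      = ennreal (r ^ (2 * m + DIM('a) - 1) * exp (- r\<^sup>2)) * indicator {0<..} r"
      by (simp add: ennreal_mult[symmetric] mult_ac split: split_indicator)
  qed
  also have "(\<integral>\<^sup>+r. ennreal (r ^ (2 * m + DIM('a) - 1) * exp (- r\<^sup>2)) * indicator {0<..} r \<partial>lborel)
      = ennreal (Gamma (real m + DIM('a) / 2) / 2)"
  proof -
    have "real (2 * m + DIM('a) - 1) = real (2 * m + DIM('a)) - 1"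
      using DIM_positive[where 'a='a] by linarith
    then have "(real (2 * m + DIM('a) - 1) + 1) / 2 = real m + DIM('a) / 2"
      by (simp add: add_divide_distrib)
    then show ?thesis by (simp only: nn_integral_power_gaussian_pos)
  qed
  also have "ennreal M * ennreal (Gamma (real m + DIM('a) / 2) / 2) = ennreal (M * (Gamma (real m + DIM('a) / 2) / 2))"
    using \<open>M \<ge> 0\<close> by (rule ennreal_mult'[symmetric])
  finally have "Gamma (real m + 1 / 2) * sqrt pi ^ (DIM('a) - 1) = M * (Gamma (real m + DIM('a) / 2) / 2)"
    using \<open>M \<ge> 0\<close> G by (subst (asm) ennreal_inj) simp_all
  then have "M = 2 * sqrt pi ^ (DIM('a) - 1) * Gamma (real m + 1 / 2) / Gamma (real m + DIM('a) / 2)"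
    using G by (simp add: field_simps)
  then show ?thesis using z M by simp
qed

section \<open>Power series of sinh and of the Bessel function\<close>

text \<open>The even terms vanish, so reindexing by the odd numbers keeps the sum.\<close>

lemma sinh_sums: "(\<lambda>k. y ^ (2 * k + 1) / fact (2 * k + 1)) sums sinh (y :: real)"
proof -
  have "(\<lambda>n. if even n then 0 else y ^ n / fact n) sums sinh y"
    using sinh_converges[of y] by (simp add: divide_inverse_commute scaleR_conv_of_real cong: if_cong)
  then have "(\<lambda>k. (\<lambda>n. if even n then 0 else y ^ n / fact n) (2 * k + 1)) sums sinh y"
    by (subst sums_mono_reindex[of "\<lambda>k. 2 * k + 1"]) (auto simp: strict_mono_def image_iff elim!: oddE)
  then show ?thesis by simp
qed

text \<open>The Pochhammer factor is at least 1, so each Gamma value in a denominator is bounded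
  below by \<open>Gamma (nu + 1)\<close>, and an exponential series in
  \<open>(x / 2)\<^sup>2\<close> dominates.\<close>

lemma summable_bessel_I:
  assumes "nu \<ge> 0" "x > 0"
  shows "summable (\<lambda>k. (x / 2) powr (2 * real k + nu) / (fact k * Gamma (real k + nu + 1)))"
proof (rule summable_comparison_test')
  show "summable (\<lambda>k. (x / 2) powr nu / Gamma (nu + 1) * (inverse (fact k) * ((x / 2)\<^sup>2) ^ k))"
    by (intro summable_mult summable_exp)
  fix k :: nat
  have pos: "Gamma (nu + 1) > 0" using assms by (intro Gamma_real_pos) auto
  have "pochhammer (nu + 1) k \<ge> 1"
    unfolding pochhammer_prod using assms by (intro prod_ge_1) auto
  moreover have "Gamma (real k + nu + 1) = pochhammer (nu + 1) k * Gamma (nu + 1)"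
  proof -
    have "nu + 1 \<notin> \<int>\<^sub>\<le>\<^sub>0" using nonpos_Ints_nonpos[of "nu + 1"] assms by auto
    from pochhammer_Gamma[OF this, of k] show ?thesis using pos by (simp add: add_ac)
  qed
  ultimately have le: "Gamma (nu + 1) \<le> Gamma (real k + nu + 1)"
    using pos by simp
  have "(x / 2) powr (2 * real k) = ((x / 2)\<^sup>2) ^ k"
    using powr_realpow[of "x / 2" "2 * k"] assms by (simp add: power_mult)
  then have eq: "(x / 2) powr (2 * real k + nu) = (x / 2) powr nu * ((x / 2)\<^sup>2) ^ k"
    by (simp only: powr_add mult.commute)
  have "norm ((x / 2) powr (2 * real k + nu) / (fact k * Gamma (real k + nu + 1)))
      = (x / 2) powr nu * ((x / 2)\<^sup>2) ^ k / (fact k * Gamma (real k + nu + 1))"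
    unfolding eq using le pos by (intro abs_of_nonneg[THEN trans[OF real_norm_def]]) simp
  also have "\<dots> \<le> (x / 2) powr nu * ((x / 2)\<^sup>2) ^ k / (fact k * Gamma (nu + 1))"
    using le pos by (intro divide_left_mono mult_left_mono mult_pos_pos) auto
  also have "\<dots> = (x / 2) powr nu / Gamma (nu + 1) * (inverse (fact k) * ((x / 2)\<^sup>2) ^ k)"
    by (simp only: divide_inverse inverse_mult_distrib mult_ac)
  finally show "norm ((x / 2) powr (2 * real k + nu) / (fact k * Gamma (real k + nu + 1)))
    \<le> (x / 2) powr nu / Gamma (nu + 1) * (inverse (fact k) * ((x / 2)\<^sup>2) ^ k)" .
qed

lemma bessel_I_pos:
  assumes "nu \<ge> 0" "x > 0"
  shows "bessel_I nu x > 0"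
  unfolding bessel_I_def using assms
  by (intro suminf_pos summable_bessel_I) (auto intro!: divide_pos_pos mult_pos_pos Gamma_real_pos)

section \<open>The mean of the von Mises--Fisher distribution\<close>

text \<open>Up to the factor \<open>vmf_const\<close>, this is the component along \<open>w\<close>
  of the mean of the distribution \<open>vMF z \<kappa>\<close>.\<close>

definition sphere_exp_integral :: "real \<Rightarrow> 'a::euclidean_space \<Rightarrow> 'a \<Rightarrow> real" where
  "sphere_exp_integral \<kappa> z w = (\<integral>x. exp (\<kappa> * (z \<bullet> x)) * (w \<bullet> x) \<partial>sphere_measure)"

lemma integrable_sphere_exp:
  "integrable sphere_measure (\<lambda>x::'a::euclidean_space. exp (\<kappa> * (z \<bullet> x)) * (w \<bullet> x))"
  by (intro integrable_sphere_measure continuous_intros)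

text \<open>An instance of the duplication formula. It merges the odd factorial of sinh with the
  half-integer Gamma value of the moment, leaving the \<open>fact k\<close> of the Bessel
  coefficients.\<close>

lemma Gamma_half_term:
  "2 * Gamma (real k + 3 / 2) / fact (2 * k + 1) = sqrt pi / (2 ^ (2 * k) * fact k)"
proof -
  have "s * (2 * x * F) / (4 * P * (x * K)) * 2 / F = s / (P * K)"
    if "x > 0" "F > 0" "P > 0" "K > 0" for x s F P K :: real
    using that by (simp add: field_simps)
  from this[of "real k + 1" "fact (2 * k + 1)" "2 ^ (2 * k)" "fact k" "sqrt pi"]
  have "sqrt pi * (2 * (real k + 1) * fact (2 * k + 1)) / (4 * 2 ^ (2 * k) * ((real k + 1) * fact k)) * 2
      / fact (2 * k + 1) = sqrt pi / (2 ^ (2 * k) * fact k)" by simp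
  moreover have "Gamma (real k + 3 / 2)
      = sqrt pi * (2 * (real k + 1) * fact (2 * k + 1)) / (4 * 2 ^ (2 * k) * ((real k + 1) * fact k))"
  proof -
    have f: "fact (2 * Suc k) = 2 * (real k + 1) * fact (2 * k + 1)" by (simp add: algebra_simps)
    have g: "fact (Suc k) = (real k + 1) * fact k" by simp
    have h: "2 ^ (2 * Suc k) = 4 * (2 :: real) ^ (2 * k)" by simp
    have "Gamma (real k + 3 / 2) = Gamma (real (Suc k) + 1 / 2)" by (simp add: add_ac)
    then show ?thesis by (simp only: Gamma_nat_plus_half f g h)
  qed
  ultimately show ?thesis by (simp only: mult.commute[of 2])
qed

lemma sphere_exp_integral_diag:
  fixes z :: "'a::euclidean_space"
  assumes "\<kappa> > 0" "norm z = 1"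
  shows "sphere_exp_integral \<kappa> z z
    = (2 * pi) powr (DIM('a) / 2) * \<kappa> powr (1 - DIM('a) / 2) * bessel_I (DIM('a) / 2) \<kappa>"
proof -
  let ?I = "sphere_exp_integral \<kappa> z z"
  let ?p = "real DIM('a)"
  \<comment> \<open>Here \<open>c\<close> is the expected prefactor, \<open>b\<close> lists the
    Bessel terms of order \<open>?p / 2\<close>, and \<open>a\<close> lists the coefficients of
    \<open>sinh (\<kappa> * t)\<close>.\<close>
  define c where "c = (2 * pi) powr (?p / 2) * \<kappa> powr (1 - ?p / 2)"
  define b where "b k = (\<kappa> / 2) powr (2 * real k + ?p / 2) / (fact k * Gamma (real k + ?p / 2 + 1))" for k :: nat
  define a where "a k = \<kappa> ^ (2 * k + 1) / fact (2 * k + 1)" for k :: nat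
  have a: "a k \<ge> 0" for k using assms by (simp add: a_def)
  have int: "integrable sphere_measure (\<lambda>x. exp (s * (z \<bullet> x)) * (z \<bullet> x))" for s
    by (rule integrable_sphere_exp)
  \<comment> \<open>Averaging the integral with its image under the antipodal map produces the
    sinh.\<close>
  have "orthogonal_transformation (\<lambda>x::'a. - x)"
    by (simp add: orthogonal_transformation_def linear_iff)
  from integral_sphere_measure_orthogonal_transformation[OF this, of "\<lambda>x. exp (\<kappa> * (z \<bullet> x)) * (z \<bullet> x)"]
  have "?I = (\<integral>x. - (exp (- \<kappa> * (z \<bullet> x)) * (z \<bullet> x)) \<partial>sphere_measure)"
    by (simp add: sphere_exp_integral_def)
  then have "2 * ?I = (\<integral>x. exp (\<kappa> * (z \<bullet> x)) * (z \<bullet> x) - exp (- \<kappa> * (z \<bullet> x)) * (z \<bullet> x) \<partial>sphere_measure)"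
    by (subst Bochner_Integration.integral_diff[OF int int]) (simp add: sphere_exp_integral_def)
  also have "\<dots> = (\<integral>x. 2 * ((z \<bullet> x) * sinh (\<kappa> * (z \<bullet> x))) \<partial>sphere_measure)"
    by (intro Bochner_Integration.integral_cong) (simp_all add: sinh_def algebra_simps)
  finally have I: "?I = (\<integral>x. (z \<bullet> x) * sinh (\<kappa> * (z \<bullet> x)) \<partial>sphere_measure)"
    by simp
  have sinh_nonneg: "t * sinh (\<kappa> * t) \<ge> 0" for t
    using assms by (cases "t \<ge> 0") (auto simp: zero_le_mult_iff mult_nonneg_nonpos)
  then have "?I \<ge> 0" unfolding I by (intro integral_nonneg_AE) auto
  have series: "(\<lambda>k. a k * t ^ (2 * (k + 1))) sums (t * sinh (\<kappa> * t))" for t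
    using sums_mult[OF sinh_sums[of "\<kappa> * t"], of t] by (simp add: a_def power_mult_distrib mult_ac)
  have nonneg: "a k * t ^ (2 * (k + 1)) \<ge> 0" for t k
    using a[of k] by (intro mult_nonneg_nonneg zero_le_even_power) auto
  have cb: "c * b k \<ge> 0" for k
    unfolding c_def b_def using assms
    by (intro mult_nonneg_nonneg divide_nonneg_nonneg less_imp_le[OF Gamma_real_pos] add_nonneg_pos) auto
  \<comment> \<open>All terms are nonnegative, so in extended reals the sum and the integral may be
    exchanged without a dominating function.\<close>
  have "ennreal ?I = (\<integral>\<^sup>+x. ennreal ((z \<bullet> x) * sinh (\<kappa> * (z \<bullet> x))) \<partial>sphere_measure)"
    unfolding I using sinh_nonneg
    by (intro nn_integral_eq_integral[symmetric] integrable_sphere_measure continuous_intros) auto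
  also have "\<dots> = (\<integral>\<^sup>+x. (\<Sum>k. ennreal (a k * (z \<bullet> x) ^ (2 * (k + 1)))) \<partial>sphere_measure)"
    using series nonneg by (intro nn_integral_cong suminf_ennreal_eq[symmetric]) auto
  also have "\<dots> = (\<Sum>k. \<integral>\<^sup>+x. ennreal (a k * (z \<bullet> x) ^ (2 * (k + 1))) \<partial>sphere_measure)"
    by (intro nn_integral_suminf) measurable
  also have "\<dots> = (\<Sum>k. ennreal (c * b k))"
  proof (intro suminf_cong)
    \<comment> \<open>The extra factor \<open>z \<bullet> x\<close> raises the powers to
      \<open>2 * (k + 1)\<close>. The moment of index \<open>k + 1\<close> then has the denominator
      \<open>Gamma (real k + ?p / 2 + 1)\<close> of the Bessel function of order
      \<open>?p / 2\<close>.\<close>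
    fix k
    have "(\<integral>\<^sup>+x. ennreal (a k * (z \<bullet> x) ^ (2 * (k + 1))) \<partial>sphere_measure)
        = ennreal (a k) * (\<integral>\<^sup>+x. ennreal ((z \<bullet> x) ^ (2 * (k + 1))) \<partial>sphere_measure)"
      by (subst nn_integral_cmult[symmetric]) (simp_all only: ennreal_mult'[OF a], measurable)
    also have "\<dots> = ennreal (a k *
        (2 * sqrt pi ^ (DIM('a) - 1) * Gamma (real (k + 1) + 1 / 2) / Gamma (real (k + 1) + ?p / 2)))"
      by (simp only: sphere_measure_even_moment[OF assms(2)] ennreal_mult'[OF a])
    also have "a k *
        (2 * sqrt pi ^ (DIM('a) - 1) * Gamma (real (k + 1) + 1 / 2) / Gamma (real (k + 1) + ?p / 2)) = c * b k"
    proof -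
      have "a k *
          (2 * sqrt pi ^ (DIM('a) - 1) * Gamma (real (k + 1) + 1 / 2) / Gamma (real (k + 1) + ?p / 2))
        = \<kappa> ^ (2 * k + 1) * sqrt pi ^ (DIM('a) - 1) * (2 * Gamma (real k + 3 / 2) / fact (2 * k + 1)) / Gamma (real k + ?p / 2 + 1)"
        by (simp add: a_def add_ac)
      also have "\<dots> = \<kappa> ^ (2 * k + 1) * (sqrt pi ^ (DIM('a) - 1) * sqrt pi) / (2 ^ (2 * k) * fact k * Gamma (real k + ?p / 2 + 1))"
        unfolding Gamma_half_term by simp
      also have "sqrt pi ^ (DIM('a) - 1) * sqrt pi = pi powr (?p / 2)"
      proof -
        have "sqrt pi ^ (DIM('a) - 1) * sqrt pi = sqrt pi ^ DIM('a)"
          using DIM_positive[where 'a='a] by (simp add: power_Suc2[symmetric] del: power_Suc2)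
        also have "\<dots> = pi powr (?p / 2)"
          by (simp add: powr_half_sqrt[symmetric] powr_power)
        finally show ?thesis .
      qed
      also have "\<kappa> ^ (2 * k + 1) * pi powr (?p / 2) / (2 ^ (2 * k) * fact k * Gamma (real k + ?p / 2 + 1)) = c * b k"
      proof -
        \<comment> \<open>The exponent is split so that one part belongs to \<open>c\<close> and the
          other to the Bessel term.\<close>
        have "\<kappa> ^ (2 * k + 1) = \<kappa> powr (1 - ?p / 2) * \<kappa> powr (2 * real k + ?p / 2)"
          using assms powr_realpow[of \<kappa> "2 * k + 1"] by (simp add: powr_add[symmetric] add_ac)
        moreover have "(\<kappa> / 2) powr (2 * real k + ?p / 2) = \<kappa> powr (2 * real k + ?p / 2) / (2 ^ (2 * k) * 2 powr (?p / 2))"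
          using assms powr_realpow[of 2 "2 * k"] by (simp add: powr_divide powr_add)
        ultimately show ?thesis
          by (simp add: c_def b_def powr_mult mult_ac)
      qed
      finally show ?thesis .
    qed
    finally show "(\<integral>\<^sup>+x. ennreal (a k * (z \<bullet> x) ^ (2 * (k + 1))) \<partial>sphere_measure)
      = ennreal (c * b k)" .
  qed
  finally have eq: "ennreal ?I = (\<Sum>k. ennreal (c * b k))" .
  have "summable b"
    unfolding b_def using assms by (intro summable_bessel_I) auto
  then have "(\<lambda>k. c * b k) sums (c * bessel_I (?p / 2) \<kappa>)"
    unfolding bessel_I_def b_def by (intro sums_mult summable_sums)
  then have "(\<Sum>k. ennreal (c * b k)) = ennreal (c * bessel_I (?p / 2) \<kappa>)"
    using cb by (intro suminf_ennreal_eq) auto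
  moreover have "c * bessel_I (?p / 2) \<kappa> \<ge> 0"
    unfolding c_def using assms by (intro mult_nonneg_nonneg less_imp_le[OF bessel_I_pos]) auto
  ultimately show ?thesis using eq \<open>?I \<ge> 0\<close> by (simp add: c_def)
qed

text \<open>The reflection that fixes \<^term>\<open>z\<close> and negates its orthogonal complement kills the
  components of the mean orthogonal to \<^term>\<open>z\<close>.\<close>
lemma sphere_exp_integral_eq:
  fixes z w :: "'a::euclidean_space"
  assumes "norm z = 1"
  shows "sphere_exp_integral \<kappa> z w = (z \<bullet> w) * sphere_exp_integral \<kappa> z z"
proof -
  define T where "T x = (2 * (z \<bullet> x)) *\<^sub>R z - x" for x
  have zz: "z \<bullet> z = 1" using assms by (simp add: norm_eq_1)
  have "linear T"
    by (rule linearI) (simp_all add: T_def algebra_simps)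
  moreover have "T x \<bullet> T y = x \<bullet> y" for x y
    using zz by (simp add: T_def inner_diff_left inner_diff_right inner_commute)
  ultimately have "orthogonal_transformation T" by (simp add: orthogonal_transformation_def)
  \<comment> \<open>Since \<open>z \<bullet> T x = z \<bullet> x\<close>, the exponential weight is
    unchanged, while \<open>w \<bullet> T x\<close> becomes
    \<open>2 * (z \<bullet> w) * (z \<bullet> x) - w \<bullet> x\<close>. The unknown integral
    reappears with a minus sign and can be solved for.\<close>
  from integral_sphere_measure_orthogonal_transformation[OF this, of "\<lambda>x. exp (\<kappa> * (z \<bullet> x)) * (w \<bullet> x)"]
  have "sphere_exp_integral \<kappa> z w
      = (\<integral>x. 2 * (z \<bullet> w) * (exp (\<kappa> * (z \<bullet> x)) * (z \<bullet> x)) - exp (\<kappa> * (z \<bullet> x)) * (w \<bullet> x) \<partial>sphere_measure)"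
    using zz by (simp add: sphere_exp_integral_def T_def inner_diff_right inner_commute algebra_simps)
  also have "\<dots> = 2 * (z \<bullet> w) * sphere_exp_integral \<kappa> z z - sphere_exp_integral \<kappa> z w"
    unfolding sphere_exp_integral_def
    by (subst Bochner_Integration.integral_diff) (auto intro!: integrable_mult_right integrable_sphere_exp)
  finally show ?thesis by simp
qed

section \<open>The divergence and the InfoNCE losses\<close>

text \<open>With equal concentrations the normalising constants cancel in the density ratio, so its
  logarithm is linear in \<open>x\<close> and only the mean along \<open>z - w\<close>
  remains.\<close>

lemma KL_vMF:
  fixes z w :: "'a::euclidean_space"
  assumes "DIM('a) \<ge> 2" "\<kappa> > 0" "norm z = 1"
  shows "KL (vMF z \<kappa>) (vMF w \<kappa>) = bessel_ratio_A DIM('a) \<kappa> * \<kappa> * (1 - z \<bullet> w)"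
proof -
  interpret S: finite_measure "sphere_measure :: 'a measure" by (rule finite_measure_sphere_measure)
  let ?p = "real DIM('a)"
  let ?c = "vmf_const DIM('a) \<kappa>"
  let ?f = "\<lambda>v x::'a. ?c * exp (\<kappa> * (v \<bullet> x))"
  have I: "bessel_I (?p / 2 - 1) \<kappa> > 0"
    using assms by (intro bessel_I_pos) auto
  then have c: "?c > 0" using assms by (simp add: vmf_const_def)
  have "KL (vMF z \<kappa>) (vMF w \<kappa>) = (\<integral>x. ?f z x * log (exp 1) (?f z x / ?f w x) \<partial>sphere_measure)"
    unfolding KL_def vMF_def using c by (intro S.KL_density_density) auto
  also have "\<dots> = (\<integral>x. ?c * \<kappa> * (exp (\<kappa> * (z \<bullet> x)) * ((z - w) \<bullet> x)) \<partial>sphere_measure)"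
  proof (intro Bochner_Integration.integral_cong refl)
    fix x :: 'a
    have "?f z x / ?f w x = exp (\<kappa> * ((z - w) \<bullet> x))"
      using c by (simp add: exp_diff[symmetric] inner_diff_left right_diff_distrib)
    then have "log (exp 1) (?f z x / ?f w x) = \<kappa> * ((z - w) \<bullet> x)"
      by (simp add: log_def)
    then show "?f z x * log (exp 1) (?f z x / ?f w x) = ?c * \<kappa> * (exp (\<kappa> * (z \<bullet> x)) * ((z - w) \<bullet> x))"
      by simp
  qed
  also have "\<dots> = ?c * \<kappa> * sphere_exp_integral \<kappa> z (z - w)"
    by (simp add: sphere_exp_integral_def)
  also have "\<dots> = ?c * sphere_exp_integral \<kappa> z z * \<kappa> * (1 - z \<bullet> w)"
    using assms by (subst sphere_exp_integral_eq) (simp_all add: inner_diff_right norm_eq_1)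
  also have "?c * sphere_exp_integral \<kappa> z z = bessel_ratio_A DIM('a) \<kappa>"
  proof -
    \<comment> \<open>The powers of \<open>\<kappa>\<close> and of \<open>2 * pi\<close> in
      \<open>vmf_const\<close> are inverse to those in \<open>sphere_exp_integral_diag\<close>; what
      remains is the quotient of two Bessel functions.\<close>
    have "\<kappa> powr (?p / 2 - 1) * \<kappa> powr (1 - ?p / 2) = 1"
      using assms by (simp flip: powr_add)
    then show ?thesis
      using assms I by (simp add: sphere_exp_integral_diag vmf_const_def bessel_ratio_A_def field_simps)
  qed
  finally show ?thesis .
qed

text \<open>A common shift \<open>C\<close> multiplies numerator and denominator of the softmax by
  \<open>exp C\<close>. The two similarities may act on different types, so distributions can be
  compared with vectors.\<close>

lemma infoNCE_shift:
  assumes "s a b = s' a' b' + C" and "\<And>j. j \<in> J \<Longrightarrow> s a (n j) = s' a' (n' j) + C"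
  shows "infoNCE s a b n J = infoNCE s' a' b' n' J"
proof -
  have "(\<Sum>j\<in>J. exp (s a (n j))) = exp C * (\<Sum>j\<in>J. exp (s' a' (n' j)))"
    using assms(2) by (simp add: exp_add sum_distrib_left mult.commute)
  then have "exp (s a b) + (\<Sum>j\<in>J. exp (s a (n j))) = exp C * (exp (s' a' b') + (\<Sum>j\<in>J. exp (s' a' (n' j))))"
    using assms(1) by (simp add: exp_add algebra_simps)
  then show ?thesis
    using assms(1) by (simp add: infoNCE_def exp_add)
qed

theorem theorem1:
  fixes tau kappa :: real
  assumes p2: "DIM('a::euclidean_space) \<ge> 2"
    and tau: "tau > 0" and kappa: "kappa > 0"
    and hA: "bessel_ratio_A DIM('a) kappa * kappa = 1 / tau"
  shows "(\<exists>C. \<forall>zi \<in> sphere (0::'a) 1. \<forall>zj \<in> sphere (0::'a) 1.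
            sim_div (vMF zi kappa) (vMF zj kappa) = sim_cos zi zj / tau + C)
       \<and> (\<forall>(zi::'a) zp (z :: nat \<Rightarrow> 'a) (J :: nat set).
            finite J \<longrightarrow> zi \<in> sphere 0 1 \<longrightarrow> zp \<in> sphere 0 1 \<longrightarrow>
            (\<forall>j\<in>J. z j \<in> sphere 0 1) \<longrightarrow>
            infoNCE sim_div (vMF zi kappa) (vMF zp kappa) (\<lambda>j. vMF (z j) kappa) J
            = infoNCE (\<lambda>x y. sim_cos x y / tau) zi zp z J)"
proof -
  \<comment> \<open>By \<open>hA\<close> the divergence is
    \<open>(1 - zi \<bullet> zj) / tau\<close>; its constant part, negated, is the witness
    \<open>- 1 / tau\<close>.\<close>
  have sim: "sim_div (vMF zi kappa) (vMF zj kappa) = sim_cos zi zj / tau + (- 1 / tau)"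
    if "zi \<in> sphere 0 1" for zi zj :: 'a
    using that KL_vMF[OF p2 kappa, of zi zj]
    by (simp add: sim_div_def sim_cos_def hA diff_divide_distrib)
  show ?thesis
  proof (intro conjI exI allI impI ballI)
    show "sim_div (vMF zi kappa) (vMF zj kappa) = sim_cos zi zj / tau + (- 1 / tau)"
      if "zi \<in> sphere 0 1" for zi zj :: 'a
      using that by (rule sim)
    fix zi zp :: 'a and z :: "nat \<Rightarrow> 'a" and J :: "nat set"
    assume "zi \<in> sphere 0 1"
    then show "infoNCE sim_div (vMF zi kappa) (vMF zp kappa) (\<lambda>j. vMF (z j) kappa) J
        = infoNCE (\<lambda>x y. sim_cos x y / tau) zi zp z J"
      by (intro infoNCE_shift[where C = "- 1 / tau"] sim)
  qed
qed

end
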